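(* Let $G$ be a non-abelian group of cardinality $|G| \leq c$, where $c = 2^{\aleph_0}$. Then $G$ is natural if and only if $G$ is not a generalized dicyclic group.
   Context: A group $(G,* )$ is called natural if there exists a metric $d$ on the set $G$ such that (i) all right translations $x \mapsto x*a$ ($a \in G$) are isometries of $(G,d)$, and (ii) every group structure $(G,\circ)$ on the same set $G$ for which all right translations $x \mapsto x \circ a$ are isometries of $(G,d)$ is isomorphic as a group to $(G,* )$. Generalized dicyclic groups: let $A$ be an abelian group and $y \in A$ an involution ($y \neq 1$, $y^2=1$). Adjoin an element $x \notin A$ with $x^2 = y$ and $x a x^{-1} = a^{-1}$ for all $a \in A$; the resulting group $\mathrm{Dic}(A,y) = \langle A, x \mid x^2=y,\ xax^{-1}=a^{-1}\ \forall a \in A\rangle$ contains $A$ as a subgroup of index $2$. It is called a generalized dicyclic group if it is non-abelian. A group is generalized dicyclic if it is isomorphic to such a group. *)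

theory Defs
  imports
    "HOL-Library.Equipollence"
    "HOL-Algebra.Coset"
    "HOL-Analysis.Abstract_Metric_Spaces"
begin

definition self_isometry :: "'a set \<Rightarrow> ('a \<Rightarrow> 'a \<Rightarrow> real) \<Rightarrow> ('a \<Rightarrow> 'a) \<Rightarrow> bool" where
  "self_isometry M d f \<longleftrightarrow>
     bij_betw f M M \<and> (\<forall>x\<in>M. \<forall>y\<in>M. d (f x) (f y) = d x y)"

definition right_translations_isometric :: "('a, 'b) monoid_scheme \<Rightarrow> ('a \<Rightarrow> 'a \<Rightarrow> real) \<Rightarrow> bool" where
  "right_translations_isometric G d \<longleftrightarrow>
     (\<forall>a\<in>carrier G. self_isometry (carrier G) d (\<lambda>x. x \<otimes>\<^bsub>G\<^esub> a))"

definition natural_group :: "('a, 'b) monoid_scheme \<Rightarrow> bool" where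
  "natural_group G \<longleftrightarrow> group G \<and>
     (\<exists>d. Metric_space (carrier G) d \<and> right_translations_isometric G d \<and>
          (\<forall>H :: 'a monoid. group H \<and> carrier H = carrier G \<and> right_translations_isometric H d
             \<longrightarrow> H \<cong> G))"

text \<open>
  The pair \<open>(a, False)\<close> stands for \<open>a\<close> and \<open>(a, True)\<close> for \<open>a x\<close>.
  The multiplication is forced by \<open>x b = b\<^sup>-\<^sup>1 x\<close> and \<open>x\<^sup>2 = y\<close>.
\<close>

definition Dic :: "('a, 'b) monoid_scheme \<Rightarrow> 'a \<Rightarrow> ('a \<times> bool) monoid" where
  "Dic A y =
     \<lparr>carrier = carrier A \<times> UNIV,
      mult = (\<lambda>(a, i) (b, j).
        (a \<otimes>\<^bsub>A\<^esub> (if i then inv\<^bsub>A\<^esub> b else b) \<otimes>\<^bsub>A\<^esub> (if i \<and> j then y else \<one>\<^bsub>A\<^esub>), i \<noteq> j)),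
      one = (\<one>\<^bsub>A\<^esub>, False)\<rparr>"

definition is_involution :: "('a, 'b) monoid_scheme \<Rightarrow> 'a \<Rightarrow> bool" where
  "is_involution A y \<longleftrightarrow> y \<in> carrier A \<and> y \<noteq> \<one>\<^bsub>A\<^esub> \<and> y \<otimes>\<^bsub>A\<^esub> y = \<one>\<^bsub>A\<^esub>"

text \<open>
  The abelian group \<open>A\<close> is taken over the element type of \<open>G\<close>. This is no restriction, because
  \<open>A\<close> embeds into \<open>G\<close>; see \<open>generalized_dicyclicI\<close> below.
\<close>

definition generalized_dicyclic :: "('a, 'b) monoid_scheme \<Rightarrow> bool" where
  "generalized_dicyclic G \<longleftrightarrow>
     (\<exists>(A :: 'a monoid) y. comm_group A \<and> is_involution A y \<and>
        \<not> comm_group (Dic A y) \<and> Dic A y \<cong> G)"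

lemma carrier_Dic: "carrier (Dic A y) = carrier A \<times> UNIV"
  and one_Dic: "\<one>\<^bsub>Dic A y\<^esub> = (\<one>\<^bsub>A\<^esub>, False)"
  and mult_Dic: "(a, i) \<otimes>\<^bsub>Dic A y\<^esub> (b, j) =
    (a \<otimes>\<^bsub>A\<^esub> (if i then inv\<^bsub>A\<^esub> b else b) \<otimes>\<^bsub>A\<^esub> (if i \<and> j then y else \<one>\<^bsub>A\<^esub>), i \<noteq> j)"
  by (simp_all add: Dic_def)

lemma inv_involution:
  assumes "comm_group A" "is_involution A y"
  shows "inv\<^bsub>A\<^esub> y = y"
proof -
  interpret A: comm_group A by fact
  show ?thesis using assms(2) by (simp add: is_involution_def A.inv_equality)
qed

lemma group_Dic:
  assumes "comm_group A" "is_involution A y"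
  shows "group (Dic A y)"
proof -
  interpret A: comm_group A by fact
  have y: "y \<in> carrier A" "y \<otimes>\<^bsub>A\<^esub> y = \<one>\<^bsub>A\<^esub>" "inv\<^bsub>A\<^esub> y = y"
    using assms(2) inv_involution[OF assms] by (simp_all add: is_involution_def)
  have yy: "y \<otimes>\<^bsub>A\<^esub> (y \<otimes>\<^bsub>A\<^esub> c) = c" if "c \<in> carrier A" for c
    using that y by (simp flip: A.m_assoc)
  show ?thesis
  proof (rule groupI)
    fix p q r
    assume "p \<in> carrier (Dic A y)" "q \<in> carrier (Dic A y)" "r \<in> carrier (Dic A y)"
    then show "p \<otimes>\<^bsub>Dic A y\<^esub> q \<otimes>\<^bsub>Dic A y\<^esub> r = p \<otimes>\<^bsub>Dic A y\<^esub> (q \<otimes>\<^bsub>Dic A y\<^esub> r)"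
      using y by (auto simp: carrier_Dic mult_Dic yy A.inv_mult A.m_ac)
  next
    fix p assume "p \<in> carrier (Dic A y)"
    then obtain a i where p: "p = (a, i)" "a \<in> carrier A" by (auto simp: carrier_Dic)
    show "\<exists>q\<in>carrier (Dic A y). q \<otimes>\<^bsub>Dic A y\<^esub> p = \<one>\<^bsub>Dic A y\<^esub>"
      by (rule bexI[of _ "if i then (a \<otimes>\<^bsub>A\<^esub> y, True) else (inv\<^bsub>A\<^esub> a, False)"])
         (use p y in \<open>auto simp: carrier_Dic mult_Dic one_Dic yy A.m_ac\<close>)
  qed (use y in \<open>auto simp: carrier_Dic mult_Dic one_Dic\<close>)
qed

lemma Dic_relations:
  assumes "comm_group A" "is_involution A y"
  shows "(\<lambda>a. (a, False)) \<in> mon A (Dic A y)"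
    and "(\<one>\<^bsub>A\<^esub>, True) \<otimes>\<^bsub>Dic A y\<^esub> (\<one>\<^bsub>A\<^esub>, True) = (y, False)"
    and "a \<in> carrier A \<Longrightarrow>
      (\<one>\<^bsub>A\<^esub>, True) \<otimes>\<^bsub>Dic A y\<^esub> (a, False) \<otimes>\<^bsub>Dic A y\<^esub> inv\<^bsub>Dic A y\<^esub> (\<one>\<^bsub>A\<^esub>, True) = (inv\<^bsub>A\<^esub> a, False)"
    and "a \<in> carrier A \<Longrightarrow> (a, False) \<otimes>\<^bsub>Dic A y\<^esub> (\<one>\<^bsub>A\<^esub>, True) = (a, True)"
proof -
  interpret A: comm_group A by fact
  interpret D: group "Dic A y" using assms by (rule group_Dic)
  have y: "y \<in> carrier A" using assms by (auto simp: is_involution_def)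
  show "(\<lambda>a. (a, False)) \<in> mon A (Dic A y)"
    by (auto simp: mon_def hom_def carrier_Dic mult_Dic inj_on_def)
  show "(\<one>\<^bsub>A\<^esub>, True) \<otimes>\<^bsub>Dic A y\<^esub> (\<one>\<^bsub>A\<^esub>, True) = (y, False)"
    using y by (simp add: mult_Dic)
  show "(a, False) \<otimes>\<^bsub>Dic A y\<^esub> (\<one>\<^bsub>A\<^esub>, True) = (a, True)" if "a \<in> carrier A"
    using that by (simp add: mult_Dic)
  show "(\<one>\<^bsub>A\<^esub>, True) \<otimes>\<^bsub>Dic A y\<^esub> (a, False) \<otimes>\<^bsub>Dic A y\<^esub> inv\<^bsub>Dic A y\<^esub> (\<one>\<^bsub>A\<^esub>, True) = (inv\<^bsub>A\<^esub> a, False)"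
    if "a \<in> carrier A"
    by (rule D.inv_solve_right'[THEN iffD2]) (use that in \<open>auto simp: carrier_Dic mult_Dic\<close>)
qed

text \<open>
  The universal property of the presentation of \<open>Dic A y\<close>; uniqueness is
  pointwise on the carrier.
\<close>

lemma Dic_universal:
  assumes A: "comm_group A" and yA: "is_involution A y" and H: "group H"
    and f: "f \<in> hom A H" and z: "z \<in> carrier H"
    and zz: "z \<otimes>\<^bsub>H\<^esub> z = f y"
    and zf: "\<And>a. a \<in> carrier A \<Longrightarrow> z \<otimes>\<^bsub>H\<^esub> f a \<otimes>\<^bsub>H\<^esub> inv\<^bsub>H\<^esub> z = f (inv\<^bsub>A\<^esub> a)"
  shows "\<exists>g\<in>hom (Dic A y) H. (\<forall>a\<in>carrier A. g (a, False) = f a) \<and> g (\<one>\<^bsub>A\<^esub>, True) = z"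
    and "\<lbrakk>g \<in> hom (Dic A y) H; g' \<in> hom (Dic A y) H;
          \<forall>a\<in>carrier A. g (a, False) = f a; g (\<one>\<^bsub>A\<^esub>, True) = z;
          \<forall>a\<in>carrier A. g' (a, False) = f a; g' (\<one>\<^bsub>A\<^esub>, True) = z\<rbrakk>
         \<Longrightarrow> \<forall>p\<in>carrier (Dic A y). g p = g' p"
proof -
  interpret A: comm_group A by fact
  interpret H: group H by fact
  interpret f: group_hom A H f by unfold_locales fact
  have y: "y \<in> carrier A" using yA by (auto simp: is_involution_def)
  have comm: "z \<otimes>\<^bsub>H\<^esub> f a = f (inv\<^bsub>A\<^esub> a) \<otimes>\<^bsub>H\<^esub> z" if "a \<in> carrier A" for a
    using zf[OF that] that z by (metis A.inv_closed H.inv_solve_right' H.m_closed f.hom_closed)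
  have comm': "z \<otimes>\<^bsub>H\<^esub> (f a \<otimes>\<^bsub>H\<^esub> c) = f (inv\<^bsub>A\<^esub> a) \<otimes>\<^bsub>H\<^esub> (z \<otimes>\<^bsub>H\<^esub> c)"
    if "a \<in> carrier A" "c \<in> carrier H" for a c
    using comm[OF that(1)] that z by (metis A.inv_closed H.m_assoc f.hom_closed)
  define g where "g = (\<lambda>(a, i). f a \<otimes>\<^bsub>H\<^esub> (if i then z else \<one>\<^bsub>H\<^esub>))"
  have "g \<in> hom (Dic A y) H"
    using y z by (auto simp: hom_def carrier_Dic mult_Dic g_def comm comm' zz H.m_assoc)
  then show "\<exists>g\<in>hom (Dic A y) H. (\<forall>a\<in>carrier A. g (a, False) = f a) \<and> g (\<one>\<^bsub>A\<^esub>, True) = z"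
    using z by (intro bexI[of _ g]) (auto simp: g_def)
next
  interpret A: comm_group A by fact
  assume g: "g \<in> hom (Dic A y) H" "g' \<in> hom (Dic A y) H"
    and eq: "\<forall>a\<in>carrier A. g (a, False) = f a" "g (\<one>\<^bsub>A\<^esub>, True) = z"
            "\<forall>a\<in>carrier A. g' (a, False) = f a" "g' (\<one>\<^bsub>A\<^esub>, True) = z"
  have "k (a, True) = k (a, False) \<otimes>\<^bsub>H\<^esub> k (\<one>\<^bsub>A\<^esub>, True)"
    if "k \<in> hom (Dic A y) H" "a \<in> carrier A" for k a
    using hom_mult[OF that(1), of "(a, False)" "(\<one>\<^bsub>A\<^esub>, True)"] that(2) Dic_relations(4)[OF A yA]
    by (simp add: carrier_Dic)
  then show "\<forall>p\<in>carrier (Dic A y). g p = g' p"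
    using g eq by (auto simp: carrier_Dic) (metis (full_types))
qed

lemma generalized_dicyclicI:
  fixes A :: "('c, 'd) monoid_scheme" and G :: "('a, 'b) monoid_scheme"
  assumes A: "comm_group A" and y: "is_involution A y"
    and nonab: "\<not> comm_group (Dic A y)" and iso: "Dic A y \<cong> G"
  shows "generalized_dicyclic G"
proof -
  interpret A: comm_group A by fact
  interpret D: group "Dic A y" using A y by (rule group_Dic)
  obtain h where h: "h \<in> Group.iso (Dic A y) G" using iso by (auto simp: is_iso_def)
  define k where "k = (\<lambda>a. h (a, False))"
  define k' where "k' = inv_into (carrier A) k"
  have inj: "inj_on k (carrier A)"
    using h by (auto simp: k_def iso_def bij_betw_def carrier_Dic inj_on_def)
  have k': "k' (k a) = a" if "a \<in> carrier A" for a
    using inj that by (simp add: k'_def)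
  define B :: "'a monoid" where
    "B = \<lparr>carrier = k ` carrier A, mult = (\<lambda>u v. k (k' u \<otimes>\<^bsub>A\<^esub> k' v)), one = k \<one>\<^bsub>A\<^esub>\<rparr>"
  have B: "comm_group B"
    by (rule comm_groupI) (auto simp: B_def k' A.m_ac intro!: bexI[OF _ A.inv_closed])
  interpret B: comm_group B by fact
  have invB: "inv\<^bsub>B\<^esub> (k a) = k (inv\<^bsub>A\<^esub> a)" if "a \<in> carrier A" for a
    by (rule B.inv_equality) (use that in \<open>auto simp: B_def k'\<close>)
  have inv_y: "is_involution B (k y)"
    using y inj by (auto simp: is_involution_def B_def k' dest: inj_onD)
  interpret DB: group "Dic B (k y)" using B inv_y by (rule group_Dic)
  have "(\<lambda>(a, i). (k a, i)) \<in> Group.iso (Dic A y) (Dic B (k y))"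
  proof (rule isoI)
    show "(\<lambda>(a, i). (k a, i)) \<in> hom (Dic A y) (Dic B (k y))"
      using y by (auto simp: hom_def carrier_Dic mult_Dic invB is_involution_def)
        (auto simp: B_def k')
    show "bij_betw (\<lambda>(a, i). (k a, i)) (carrier (Dic A y)) (carrier (Dic B (k y)))"
      using inj by (auto simp: bij_betw_def carrier_Dic B_def inj_on_def image_iff)
  qed
  then have AB: "Dic A y \<cong> Dic B (k y)" by (rule is_isoI)
  then have BA: "Dic B (k y) \<cong> Dic A y" by (rule D.iso_sym)
  have "\<not> comm_group (Dic B (k y))"
    using nonab comm_group.iso_imp_comm_group[OF _ BA] D.is_monoid by blast
  moreover have "Dic B (k y) \<cong> G"
    using BA iso by (rule iso_trans)
  ultimately show ?thesis
    using B inv_y by (auto simp: generalized_dicyclic_def)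
qed

end

theory Submission
  imports Defs
begin

text \<open>
  A metric with isometric right translations has the form \<open>d u v = f (u v\<^sup>-\<^sup>1)\<close> with
  \<open>f g = f (g\<^sup>-\<^sup>1)\<close>. Such a metric can never tell \<open>u v\<^sup>-\<^sup>1\<close> from its inverse, and this is the only
  information that every such metric loses: since \<open>|G| \<le> c\<close>, there are enough values in \<open>[1, 2)\<close>
  to give different ones to different pairs \<open>{g, g\<^sup>-\<^sup>1}\<close>, and the triangle inequality is automatic
  for values in that range. The question is therefore which maps \<open>\<phi>\<close> preserve all differences
  \<open>u v\<^sup>-\<^sup>1\<close> up to inversion.

  If \<open>G\<close> is non-abelian and such a \<open>\<phi>\<close> fixes \<open>\<one>\<close> but moves some \<open>h\<close>, then \<open>G\<close> is generalized
  dicyclic. Indeed \<open>\<phi> h = h\<^sup>-\<^sup>1\<close>. Comparing \<open>h\<close> with a fixed element shows that \<open>h\<close>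
  inverts it by conjugation, and comparing two moved elements shows that they commute or have
  the same square. If \<open>\<phi>\<close> fixes some \<open>f\<close> with \<open>f\<^sup>2 \<noteq> \<one>\<close>, then the centralizer of \<open>f\<close> is fixed
  pointwise, so \<open>h\<close> inverts all of it, and every element outside inverts \<open>f\<close>; hence \<open>G\<close> is
  dicyclic over the centralizer of \<open>f\<close>. Otherwise \<open>\<phi>\<close> is inversion, any two
  non-commuting elements have the same square and invert each other, and \<open>G\<close> is dicyclic over the
  centralizer of any non-central element
  (\<open>splitting_if_fixes_noninvolution\<close>, \<open>splitting_if_fixes_only_involutions\<close>).
  So if \<open>G\<close> is not generalized dicyclic, the isometries of the metric above
  are exactly the right translations of \<open>G\<close>. The right translations of any competing group \<open>H\<close>
  are then right translations of \<open>G\<close>, which forces \<open>H \<cong> G\<close> (\<open>iso_if_right_mults_agree\<close>).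

  Conversely, let \<open>G = C \<union> C x\<close> be generalized dicyclic. The map that fixes \<open>C\<close> and inverts
  every element of \<open>C x\<close> is an isometry for every right-invariant metric. Composing the
  translations by elements of \<open>C x\<close> with it gives the right translations of a
  generalized dihedral group on the same set, in which all elements of \<open>C x\<close> are involutions.
  It is not isomorphic to \<open>G\<close>, where all involutions lie in the abelian subgroup \<open>C\<close>
  (\<open>twist_isometric\<close>, \<open>twist_not_iso\<close>).
\<close>

section \<open>Word calculations in groups\<close>

lemma (in group) inv_cancel_left:
  assumes "x \<in> carrier G" "y \<in> carrier G"
  shows "x \<otimes> (inv x \<otimes> y) = y" and "inv x \<otimes> (x \<otimes> y) = y"
  using assms by (simp_all flip: m_assoc)

lemma (in group) bij_betw_right_mult:
  assumes "a \<in> carrier G"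
  shows "bij_betw (\<lambda>u. u \<otimes> a) (carrier G) (carrier G)"
  by (rule bij_betw_byWitness[where f' = "\<lambda>u. u \<otimes> inv a"]) (use assms in \<open>auto simp: m_assoc\<close>)

lemmas (in group) group_word = m_assoc inv_mult_group inv_cancel_left

text \<open>
  The remaining facts of this section are about elements that \<open>x\<close> inverts by conjugation, written
  \<open>x a = a\<^sup>-\<^sup>1 x\<close>. Inversion is a homomorphism only where elements commute; this is what makes
  a set closed under products abelian as soon as one \<open>x\<close> inverts all of it. Equality of squares is a source of
  inversion: \<open>(a b)\<^sup>2 = a\<^sup>2\<close> is another way to write \<open>b a b = a\<close>.
\<close>

lemma (in group) inverts_product_imp_commute:
  assumes "x \<in> carrier G" "a \<in> carrier G" "b \<in> carrier G"
    and "x \<otimes> a = inv a \<otimes> x" "x \<otimes> b = inv b \<otimes> x" "x \<otimes> (a \<otimes> b) = inv (a \<otimes> b) \<otimes> x"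
  shows "a \<otimes> b = b \<otimes> a"
proof -
  have "inv (a \<otimes> b) \<otimes> x = x \<otimes> a \<otimes> b" using assms(1-3,6) by (simp add: m_assoc)
  also have "\<dots> = inv a \<otimes> x \<otimes> b" using assms(4) by simp
  also have "\<dots> = inv a \<otimes> (inv b \<otimes> x)" using assms(1-3,5) by (simp add: m_assoc)
  also have "\<dots> = inv (b \<otimes> a) \<otimes> x" using assms by (simp add: group_word)
  finally have "inv (a \<otimes> b) = inv (b \<otimes> a)" using assms by simp
  then show ?thesis using assms by (metis inv_inv m_closed)
qed

lemma (in group) inverts_if_square_left_eq:
  assumes "a \<in> carrier G" "b \<in> carrier G" "a \<otimes> b \<otimes> (a \<otimes> b) = a \<otimes> a"
  shows "a \<otimes> b = inv b \<otimes> a"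
proof -
  have "b \<otimes> (a \<otimes> b) = a" using assms by (simp add: m_assoc)
  then show ?thesis using assms by (simp add: inv_solve_left)
qed

lemma (in group) inverts_if_square_right_eq:
  assumes "a \<in> carrier G" "b \<in> carrier G" "a \<otimes> b \<otimes> (a \<otimes> b) = b \<otimes> b"
  shows "b \<otimes> a = inv a \<otimes> b"
proof -
  have "a \<otimes> (b \<otimes> a) = b" using assms by (simp flip: m_assoc)
  then show ?thesis using assms by (simp add: inv_solve_left)
qed

section \<open>Generalized dicyclic groups as split over a subgroup\<close>

text \<open>
  The internal description of \<open>Dic A y\<close>, with \<open>A\<close> embedded as \<open>C\<close> and \<open>y = x\<^sup>2\<close>. As \<open>x\<close>
  inverts \<open>C\<close> and \<open>x\<^sup>2 \<noteq> \<one>\<close>, it follows that \<open>C\<close> is abelian, that \<open>x \<notin> C\<close> and that \<open>x\<^sup>2\<close> is a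
  central involution in \<open>C\<close>.
\<close>

locale dicyclic_splitting = group G for G (structure) +
  fixes C x
  assumes subgroup: "subgroup C G"
    and x_closed [simp, intro]: "x \<in> carrier G"
    and x_square: "x \<otimes> x \<noteq> \<one>"
    and inverts: "c \<in> C \<Longrightarrow> x \<otimes> c = inv c \<otimes> x"
    and cover: "\<lbrakk>w \<in> carrier G; w \<notin> C\<rbrakk> \<Longrightarrow> w \<otimes> inv x \<in> C"
begin

lemma C_closed [simp, intro]: "c \<in> C \<Longrightarrow> c \<in> carrier G"
  using subgroup subgroup.mem_carrier by fast

lemma C_subgroup [simp, intro]:
  "\<one> \<in> C" "c \<in> C \<Longrightarrow> inv c \<in> C" "\<lbrakk>a \<in> C; b \<in> C\<rbrakk> \<Longrightarrow> a \<otimes> b \<in> C"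
  using subgroup by (auto simp: subgroup_def)

lemma C_commute:
  assumes "a \<in> C" "b \<in> C"
  shows "a \<otimes> b = b \<otimes> a"
  using assms by (intro inverts_product_imp_commute[of x] inverts) auto

lemma x_notin: "x \<notin> C"
  using inverts[of x] x_square by auto

lemma outsideE:
  assumes "w \<in> carrier G" "w \<notin> C"
  obtains a where "a \<in> C" "w = a \<otimes> x"
  using cover[OF assms] assms by (metis inv_closed inv_inv inv_solve_right C_closed x_closed)

lemma mult_x_notin: "a \<in> C \<Longrightarrow> a \<otimes> x \<notin> C"
  using x_notin C_subgroup inv_cancel_left(2)[of a x] by (metis C_closed x_closed)

lemma xx_in: "x \<otimes> x \<in> C"
  using cover[of "x \<otimes> x"] x_notin by (auto simp: m_assoc)

text \<open>\<open>C\<close> is the kernel of a homomorphism onto the group of order two.\<close>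

lemma in_C_iff:
  assumes "u \<in> carrier G" "v \<in> carrier G"
  shows "u \<otimes> v \<in> C \<longleftrightarrow> (u \<in> C \<longleftrightarrow> v \<in> C)"
proof (cases "u \<in> C")
  case True
  then show ?thesis
    using assms C_subgroup(2,3) inv_cancel_left(2) by metis
next
  case u: False
  show ?thesis
  proof (cases "v \<in> C")
    case True
    then have "u \<otimes> v \<in> C \<Longrightarrow> u \<otimes> v \<otimes> inv v \<in> C" by blast
    then show ?thesis using True u assms by (auto simp: m_assoc)
  next
    case False
    obtain a b where ab: "a \<in> C" "u = a \<otimes> x" "b \<in> C" "v = b \<otimes> x"
      using outsideE assms u False by metis
    then have "u \<otimes> v = a \<otimes> (x \<otimes> b) \<otimes> x" by (simp add: m_assoc)
    also have "\<dots> = a \<otimes> inv b \<otimes> (x \<otimes> x)" using ab by (simp add: inverts m_assoc)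
    finally show ?thesis using ab u False xx_in by simp
  qed
qed

lemma outside_square:
  assumes "w \<in> carrier G" "w \<notin> C"
  shows "w \<otimes> w = x \<otimes> x"
proof -
  obtain a where a: "a \<in> C" "w = a \<otimes> x" using assms by (rule outsideE)
  have "w \<otimes> w = a \<otimes> (x \<otimes> a) \<otimes> x" using a by (simp add: m_assoc)
  also have "\<dots> = x \<otimes> x" using a by (simp add: inverts group_word)
  finally show ?thesis .
qed

text \<open>\<open>x\<close> inverts \<open>x\<^sup>2 \<in> C\<close>, but also commutes with it.\<close>

lemma xx_involution: "x \<otimes> x \<otimes> (x \<otimes> x) = \<one>"
proof -
  have "x \<otimes> x \<otimes> x = inv (x \<otimes> x) \<otimes> x" using inverts[OF xx_in] by (simp add: m_assoc)
  then have "x \<otimes> x = inv (x \<otimes> x)" by simp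
  then show ?thesis by (metis m_closed r_inv x_closed)
qed

lemma xx_central:
  assumes "w \<in> carrier G"
  shows "w \<otimes> (x \<otimes> x) = x \<otimes> x \<otimes> w"
proof (cases "w \<in> C")
  case True
  then show ?thesis using C_commute xx_in by simp
next
  case False
  then show ?thesis using outside_square[OF assms] assms m_assoc by metis
qed

theorem generalized_dicyclic:
  assumes "\<not> comm_group G"
  shows "generalized_dicyclic G"
proof (rule generalized_dicyclicI)
  let ?A = "G\<lparr>carrier := C\<rparr>"
  interpret A: group ?A using subgroup by (rule subgroup_imp_group)
  show A: "comm_group ?A"
    by (rule A.group_comm_groupI) (simp add: C_commute)
  have invA: "inv\<^bsub>?A\<^esub> c = inv c" if "c \<in> C" for c
    using subgroup that by (simp add: m_inv_consistent)
  show y: "is_involution ?A (x \<otimes> x)"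
    using xx_in x_square xx_involution by (simp add: is_involution_def)
  let ?f = "\<lambda>(a, i). a \<otimes> (if i then x else \<one>)"
  have inverts': "x \<otimes> (c \<otimes> w) = inv c \<otimes> (x \<otimes> w)" if "c \<in> C" "w \<in> carrier G" for c w
    using that inverts[of c] by (metis C_closed inv_closed m_assoc x_closed)
  have "?f \<in> hom (Dic ?A (x \<otimes> x)) G"
    by (auto simp: hom_def carrier_Dic mult_Dic invA m_assoc inverts inverts')
  moreover have "bij_betw ?f (carrier (Dic ?A (x \<otimes> x))) (carrier G)"
    unfolding bij_betw_def
  proof
    show "inj_on ?f (carrier (Dic ?A (x \<otimes> x)))"
      by (auto simp: inj_on_def carrier_Dic mult_x_notin dest: sym)
    show "?f ` carrier (Dic ?A (x \<otimes> x)) = carrier G"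
    proof safe
      fix w assume w: "w \<in> carrier G"
      show "w \<in> ?f ` carrier (Dic ?A (x \<otimes> x))"
      proof (cases "w \<in> C")
        case True
        then show ?thesis by (intro image_eqI[of _ _ "(w, False)"]) (auto simp: carrier_Dic)
      next
        case False
        then obtain a where "a \<in> C" "w = a \<otimes> x" using outsideE w by metis
        then show ?thesis by (intro image_eqI[of _ _ "(a, True)"]) (auto simp: carrier_Dic)
      qed
    qed (auto simp: carrier_Dic)
  qed
  ultimately show iso: "Dic ?A (x \<otimes> x) \<cong> G"
    by (intro is_isoI isoI)
  then show "\<not> comm_group (Dic ?A (x \<otimes> x))"
    using assms comm_group.iso_imp_comm_group is_monoid by blast
qed

end

lemma (in group) generalized_dicyclic_splitting:
  assumes "generalized_dicyclic G"
  obtains C x where "dicyclic_splitting G C x"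
proof -
  obtain A :: "'a monoid" and y h where A: "comm_group A" and y: "is_involution A y"
    and h: "h \<in> iso (Dic A y) G"
    using assms by (auto simp: generalized_dicyclic_def is_iso_def)
  interpret A: comm_group A by fact
  interpret D: group "Dic A y" using A y by (rule group_Dic)
  interpret h: group_hom "Dic A y" G h using h by unfold_locales (simp add: iso_def)
  have bij: "bij_betw h (carrier A \<times> UNIV) (carrier G)" using h by (simp add: iso_def carrier_Dic)
  have mult: "h p \<otimes> h q = h (p \<otimes>\<^bsub>Dic A y\<^esub> q)" if "p \<in> carrier A \<times> UNIV" "q \<in> carrier A \<times> UNIV" for p q
    using that by (simp add: carrier_Dic)
  have one: "h (\<one>\<^bsub>A\<^esub>, False) = \<one>" using h.hom_one by (simp add: one_Dic)
  have yA: "y \<in> carrier A" "y \<noteq> \<one>\<^bsub>A\<^esub>" using y by (auto simp: is_involution_def)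
  have hG: "h p \<in> carrier G" if "p \<in> carrier A \<times> UNIV" for p
    using that by (simp add: carrier_Dic)
  have inv: "inv (h (a, False)) = h (inv\<^bsub>A\<^esub> a, False)" if "a \<in> carrier A" for a
    by (rule inv_equality) (use that in \<open>simp_all add: mult hG mult_Dic one\<close>)
  let ?x = "h (\<one>\<^bsub>A\<^esub>, True)"
  have "dicyclic_splitting G (h ` (carrier A \<times> {False})) ?x"
  proof
    show "h ` (carrier A \<times> {False}) \<subseteq> carrier G" using hG by auto
    show "?x \<in> carrier G" by (simp add: hG)
    show "?x \<otimes> ?x \<noteq> \<one>"
    proof
      assume "?x \<otimes> ?x = \<one>"
      then have "h (y, False) = h (\<one>\<^bsub>A\<^esub>, False)" using yA by (simp add: mult mult_Dic one)
      then show False using bij yA by (auto simp: bij_betw_def inj_on_def)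
    qed
    show "w \<otimes> inv ?x \<in> h ` (carrier A \<times> {False})"
      if w: "w \<in> carrier G" "w \<notin> h ` (carrier A \<times> {False})" for w
    proof -
      have "w \<in> h ` (carrier A \<times> UNIV)" using bij w(1) by (simp add: bij_betw_def)
      then obtain a i where "a \<in> carrier A" "w = h (a, i)" by auto
      with w(2) have a: "a \<in> carrier A" "w = h (a, True)" by (cases i; auto)+
      then have "w = h (a, False) \<otimes> ?x" by (simp add: mult mult_Dic)
      then have "w \<otimes> inv ?x = h (a, False)" using a by (simp add: m_assoc hG)
      then show ?thesis using a by auto
    qed
  qed (auto simp: mult mult_Dic inv intro!: image_eqI one[symmetric])
  then show thesis by (rule that)
qed

section \<open>Generalized dicyclic groups are not natural\<close>

context dicyclic_splitting
begin

text \<open>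
  The generalized dihedral group \<open>C \<rtimes> C\<^sub>2\<close>, with underlying set that of \<open>G\<close>. The product of \<open>G\<close>
  is multiplied by the cocycle that takes the value \<open>x\<^sup>2\<close> when both factors lie outside \<open>C\<close>; since all
  elements outside \<open>C\<close> have square \<open>x\<^sup>2\<close> in \<open>G\<close>, they become involutions.
\<close>

definition twist :: "'a monoid" where
  "twist = \<lparr>carrier = carrier G,
     mult = (\<lambda>u v. if u \<in> C \<or> v \<in> C then u \<otimes> v else u \<otimes> v \<otimes> (x \<otimes> x)), one = \<one>\<rparr>"

lemma carrier_twist [simp]: "carrier twist = carrier G"
  and one_twist: "\<one>\<^bsub>twist\<^esub> = \<one>"
  and mult_twist: "u \<otimes>\<^bsub>twist\<^esub> v = (if u \<in> C \<or> v \<in> C then u \<otimes> v else u \<otimes> v \<otimes> (x \<otimes> x))"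
  by (simp_all add: twist_def)

lemma twist_square: "\<lbrakk>w \<in> carrier G; w \<notin> C\<rbrakk> \<Longrightarrow> w \<otimes>\<^bsub>twist\<^esub> w = \<one>"
  using outside_square xx_involution by (simp add: mult_twist)

lemma group_twist: "group twist"
proof (rule groupI)
  fix u v w
  assume "u \<in> carrier twist" "v \<in> carrier twist" "w \<in> carrier twist"
  then have uvw: "u \<in> carrier G" "v \<in> carrier G" "w \<in> carrier G" by simp_all
  obtain z where z: "z = x \<otimes> x" by blast
  have zC: "z \<in> C" "z \<in> carrier G" using xx_in by (auto simp: z)
  have zw: "z \<otimes> w = w \<otimes> z" using xx_central[OF uvw(3)] by (simp add: z)
  show "u \<otimes>\<^bsub>twist\<^esub> v \<otimes>\<^bsub>twist\<^esub> w = u \<otimes>\<^bsub>twist\<^esub> (v \<otimes>\<^bsub>twist\<^esub> w)"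
    using uvw zC by (simp add: mult_twist in_C_iff flip: z) (simp add: m_assoc zw)
next
  fix w assume w: "w \<in> carrier twist"
  show "\<exists>v\<in>carrier twist. v \<otimes>\<^bsub>twist\<^esub> w = \<one>\<^bsub>twist\<^esub>"
  proof (cases "w \<in> C")
    case True
    then show ?thesis by (intro bexI[of _ "inv w"]) (auto simp: mult_twist one_twist)
  next
    case False
    then show ?thesis using w by (intro bexI[of _ w]) (simp_all add: one_twist twist_square)
  qed
qed (auto simp: mult_twist one_twist)

text \<open>
  Multiplication by \<open>x\<^sup>2\<close> inverts each \<open>w \<notin> C\<close>, because \<open>w\<^sup>2 = x\<^sup>2\<close>. So applying the extra
  factor \<open>x\<^sup>2\<close> to the elements outside \<open>C\<close> only replaces some differences \<open>u v\<^sup>-\<^sup>1\<close>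
  by their inverses, which \<open>d\<close> does not notice.
\<close>

lemma twist_isometric:
  assumes d: "Metric_space (carrier G) d" and iso: "right_translations_isometric G d"
  shows "right_translations_isometric twist d"
proof -
  interpret d: Metric_space "carrier G" d by fact
  interpret T: group twist by (rule group_twist)
  have shift: "d (u \<otimes> a) (v \<otimes> a) = d u v"
    if "u \<in> carrier G" "v \<in> carrier G" "a \<in> carrier G" for u v a
    using iso that by (simp add: right_translations_isometric_def self_isometry_def)
  have flip: "d (u \<otimes> (x \<otimes> x)) v = d u v"
    if uv: "u \<in> carrier G" "v \<in> carrier G" "u \<notin> C" "v \<in> C" for u v
  proof -
    define w where "w = u \<otimes> inv v"
    have w: "w \<in> carrier G" "w \<notin> C" "u = w \<otimes> v" using uv by (auto simp: w_def in_C_iff m_assoc)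
    have "w \<otimes> (w \<otimes> (x \<otimes> x)) = \<one>"
      using outside_square[OF w(1,2)] xx_involution w(1) by (simp flip: m_assoc)
    then have wxx: "w \<otimes> (x \<otimes> x) = inv w"
      using w(1) by (metis inv_equality inv_inv m_closed x_closed)
    have "u \<otimes> (x \<otimes> x) = inv w \<otimes> v"
      using w(1,3) uv(2) xx_central[OF uv(2)] wxx by (simp add: m_assoc flip: wxx)
    then have "d (u \<otimes> (x \<otimes> x)) v = d (inv w \<otimes> v) (\<one> \<otimes> v)" using uv by simp
    also have "\<dots> = d (inv w) \<one>" using w uv by (intro shift) auto
    also have "\<dots> = d (inv w \<otimes> w) (\<one> \<otimes> w)" using w by (intro shift[symmetric]) auto
    also have "\<dots> = d w \<one>" using w d.commute by simp
    also have "\<dots> = d (w \<otimes> v) (\<one> \<otimes> v)" using w uv by (intro shift[symmetric]) auto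
    also have "\<dots> = d u v" using w uv by simp
    finally show ?thesis .
  qed
  \<comment> \<open>For \<open>u\<close> and \<open>v\<close> on the same side of \<open>C\<close>, the twisted translation by \<open>a\<close> is a translation of
    \<open>G\<close>, by \<open>a\<close> or by \<open>a x\<^sup>2\<close>. Only the mixed case needs \<open>flip\<close>.\<close>
  have "d (u \<otimes>\<^bsub>twist\<^esub> a) (v \<otimes>\<^bsub>twist\<^esub> a) = d u v"
    if uva: "u \<in> carrier G" "v \<in> carrier G" "a \<in> carrier G" for u v a
  proof -
    have 1: "d (u \<otimes> a \<otimes> (x \<otimes> x)) (v \<otimes> a) = d u v"
      if "u \<in> carrier G" "v \<in> carrier G" "u \<notin> C" "v \<in> C" for u v
    proof -
      have "u \<otimes> a \<otimes> (x \<otimes> x) = u \<otimes> (x \<otimes> x) \<otimes> a"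
        using that uva(3) xx_central[OF uva(3)] by (simp only: m_assoc m_closed x_closed)
      then show ?thesis using that uva shift flip by simp
    qed
    show ?thesis
      using uva 1[of u v] 1[of v u] shift d.commute by (auto simp: mult_twist)
  qed
  moreover have "bij_betw (\<lambda>u. u \<otimes>\<^bsub>twist\<^esub> a) (carrier G) (carrier G)" if "a \<in> carrier G" for a
    using T.bij_betw_right_mult that by simp
  ultimately show ?thesis
    by (simp add: right_translations_isometric_def self_isometry_def)
qed

text \<open>
  In \<open>G\<close> involutions commute, since they lie in \<open>C\<close>. If this held in the twisted group too,
  all elements of \<open>C x\<close> would commute with each other, and as they generate \<open>G\<close>, it would be abelian.
\<close>

lemma twist_not_iso:
  assumes "\<not> comm_group G"
  shows "\<not> twist \<cong> G"
proof
  assume "twist \<cong> G"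
  then obtain h where h: "h \<in> iso twist G" by (auto simp: is_iso_def)
  interpret T: group twist by (rule group_twist)
  interpret h: group_hom twist G h using h by unfold_locales (simp add: iso_def)
  have inj: "inj_on h (carrier G)" using h by (simp add: iso_def bij_betw_def)
  have h_in: "h w \<in> C" if w: "w \<in> carrier G" "w \<notin> C" for w
  proof (rule ccontr)
    assume "h w \<notin> C"
    then have "h w \<otimes> h w = x \<otimes> x" using w by (simp add: outside_square)
    moreover have "h w \<otimes> h w = \<one>"
      using w twist_square[OF w] h.hom_mult[of w w] h.hom_one by (simp add: one_twist)
    ultimately show False using x_square by simp
  qed
  have comm: "u \<otimes> v = v \<otimes> u" if "u \<in> carrier G" "u \<notin> C" "v \<in> carrier G" "v \<notin> C" for u v
  proof -
    have "h (u \<otimes>\<^bsub>twist\<^esub> v) = h (v \<otimes>\<^bsub>twist\<^esub> u)"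
      using that h_in C_commute h.hom_mult by simp
    then have "u \<otimes>\<^bsub>twist\<^esub> v = v \<otimes>\<^bsub>twist\<^esub> u"
      using that inj T.m_closed by (metis carrier_twist inj_onD)
    then show ?thesis using that by (simp add: mult_twist)
  qed
  have x_comm: "c \<otimes> x = x \<otimes> c" if "c \<in> C" for c
  proof -
    have "c \<otimes> x \<otimes> x = x \<otimes> (c \<otimes> x)"
      using that by (intro comm) (auto simp: x_notin mult_x_notin)
    then show ?thesis using that by (simp flip: m_assoc)
  qed
  have "u \<otimes> v = v \<otimes> u" if "u \<in> carrier G" "v \<in> carrier G" for u v
  proof -
    have mixed: "u \<otimes> v = v \<otimes> u" if uv: "u \<in> carrier G" "u \<notin> C" "v \<in> C" for u v
    proof -
      obtain a where a: "a \<in> C" "u = a \<otimes> x" using outsideE uv by metis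
      have "u \<otimes> v = a \<otimes> v \<otimes> x" using a uv by (simp add: m_assoc x_comm)
      also have "\<dots> = v \<otimes> u" using a uv by (simp add: m_assoc C_commute[of a v])
      finally show ?thesis .
    qed
    show ?thesis using that comm mixed C_commute by metis
  qed
  then show False using assms group_comm_groupI by blast
qed

theorem not_natural:
  assumes "\<not> comm_group G"
  shows "\<not> natural_group G"
  using assms group_twist twist_isometric twist_not_iso carrier_twist
  unfolding natural_group_def by blast

end

section \<open>Maps that preserve differences up to inversion\<close>

text \<open>
  Both occurrences of the dicyclic structure below are over the centralizer of one element \<open>f\<close>.
  Two elements that invert \<open>f\<close> differ by one that commutes with \<open>f\<close>, so the centralizer has index
  at most two.
\<close>

lemma (in group) centralizer_splitting:
  assumes f: "f \<in> carrier G" and x: "x \<in> carrier G" "x \<otimes> x \<noteq> \<one>"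
    and inverts: "\<And>c. \<lbrakk>c \<in> carrier G; c \<otimes> f = f \<otimes> c\<rbrakk> \<Longrightarrow> x \<otimes> c = inv c \<otimes> x"
    and outside: "\<And>w. \<lbrakk>w \<in> carrier G; w \<otimes> f \<noteq> f \<otimes> w\<rbrakk> \<Longrightarrow> w \<otimes> f = inv f \<otimes> w"
  shows "dicyclic_splitting G {c \<in> carrier G. c \<otimes> f = f \<otimes> c} x"
proof
  let ?C = "{c \<in> carrier G. c \<otimes> f = f \<otimes> c}"
  show "a \<otimes> b \<in> ?C" if "a \<in> ?C" "b \<in> ?C" for a b
  proof -
    have "a \<otimes> b \<otimes> f = a \<otimes> (f \<otimes> b)" using that f by (simp add: m_assoc)
    also have "\<dots> = a \<otimes> f \<otimes> b" using that f by (simp flip: m_assoc)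
    also have "\<dots> = f \<otimes> (a \<otimes> b)" using that f by (simp add: m_assoc)
    finally show ?thesis using that by simp
  qed
  show "inv a \<in> ?C" if "a \<in> ?C" for a
  proof -
    have "f = a \<otimes> (f \<otimes> inv a)" using that f by simp (metis inv_closed m_assoc r_inv r_one)
    then show ?thesis using that f by (simp add: inv_solve_left')
  qed
  show "w \<otimes> inv x \<in> ?C" if w: "w \<in> carrier G" "w \<notin> ?C" for w
  proof -
    have "inv x \<otimes> f = inv f \<otimes> inv x"
    proof -
      have "x = f \<otimes> x \<otimes> f" using inverts[of f] f x by (simp add: group_word)
      then have "x \<otimes> inv f = f \<otimes> x" using f x by (simp add: inv_solve_right')
      then have "f = x \<otimes> inv f \<otimes> inv x" using f x by (simp add: m_assoc)
      then have "f = x \<otimes> (inv f \<otimes> inv x)" using f x by (simp add: m_assoc)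
      then show ?thesis using f x by (simp add: inv_solve_left')
    qed
    then have "w \<otimes> inv x \<otimes> f = w \<otimes> inv f \<otimes> inv x" using w f x by (simp add: m_assoc)
    also have "\<dots> = f \<otimes> (w \<otimes> inv x)"
    proof -
      have "w = f \<otimes> w \<otimes> f" using outside[of w] w f by (simp add: group_word)
      then have "w \<otimes> inv f = f \<otimes> w" using w f by (simp add: inv_solve_right')
      then show ?thesis using w f x by (simp add: m_assoc)
    qed
    finally show ?thesis using w x by simp
  qed
qed (use f x inverts in auto)

text \<open>
  The isometries fixing \<open>\<one>\<close> of a right-invariant metric that distinguishes any two pairs
  \<open>{g, g\<^sup>-\<^sup>1}\<close>.
\<close>

locale difference_preserving_up_to_inverse = group G for G (structure) +
  fixes \<phi>
  assumes closed [simp]: "u \<in> carrier G \<Longrightarrow> \<phi> u \<in> carrier G"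
    and fixes_one: "\<phi> \<one> = \<one>"
    and differences: "\<lbrakk>u \<in> carrier G; v \<in> carrier G\<rbrakk> \<Longrightarrow>
      \<phi> u \<otimes> inv \<phi> v = u \<otimes> inv v \<or> \<phi> u \<otimes> inv \<phi> v = v \<otimes> inv u"
begin

lemma moved:
  assumes "h \<in> carrier G" "\<phi> h \<noteq> h"
  shows "\<phi> h = inv h" and "h \<otimes> h \<noteq> \<one>"
proof -
  show *: "\<phi> h = inv h" using differences[of h \<one>] assms fixes_one by simp
  show "h \<otimes> h \<noteq> \<one>" using * assms inv_equality by metis
qed

text \<open>
  The difference of \<open>f\<close> and \<open>h\<close> is \<open>f h\<^sup>-\<^sup>1\<close> before and \<open>f h\<close> after applying \<open>\<phi>\<close>. These are not
  equal, as \<open>h\<^sup>2 \<noteq> \<one>\<close>, so the second is the inverse of the first.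
\<close>

lemma moved_inverts_fixed:
  assumes h: "h \<in> carrier G" "\<phi> h \<noteq> h" and f: "f \<in> carrier G" "\<phi> f = f"
  shows "h \<otimes> f = inv f \<otimes> h"
proof -
  have "f \<otimes> h = f \<otimes> inv h \<or> f \<otimes> h = h \<otimes> inv f"
    using differences[OF f(1) h(1)] f h moved[OF h] by simp
  moreover have "h \<noteq> inv h" using moved[OF h] h by metis
  ultimately have "f \<otimes> h = h \<otimes> inv f" using f h by simp
  then have "f \<otimes> h \<otimes> f = h" using f h by (simp add: m_assoc)
  then show ?thesis using f h by (simp add: inv_solve_left m_assoc)
qed

text \<open>
  Here \<open>g h\<^sup>-\<^sup>1\<close> becomes \<open>g\<^sup>-\<^sup>1 h\<close>. Preservation of this difference means \<open>g\<^sup>2 = h\<^sup>2\<close>, its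
  inversion means that \<open>g\<close> and \<open>h\<close> commute.
\<close>

lemma moved_commute_or_squares_eq:
  assumes g: "g \<in> carrier G" "\<phi> g \<noteq> g" and h: "h \<in> carrier G" "\<phi> h \<noteq> h"
    and noncomm: "g \<otimes> h \<noteq> h \<otimes> g"
  shows "g \<otimes> g = h \<otimes> h"
proof -
  have "inv g \<otimes> h = g \<otimes> inv h \<or> inv g \<otimes> h = h \<otimes> inv g"
    using differences[OF g(1) h(1)] g h moved[OF g] moved[OF h] by simp
  moreover have "inv g \<otimes> h \<noteq> h \<otimes> inv g"
  proof
    assume "inv g \<otimes> h = h \<otimes> inv g"
    then have "h = g \<otimes> h \<otimes> inv g" using g h by (simp add: m_assoc inv_solve_left')
    then show False using noncomm g h by (simp add: inv_solve_right)
  qed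
  ultimately have "inv g \<otimes> h = g \<otimes> inv h" by simp
  then have "h = g \<otimes> g \<otimes> inv h" using g h by (simp add: m_assoc inv_solve_left')
  then show ?thesis using g h by (simp add: inv_solve_right)
qed

text \<open>
  An element cannot both commute with \<open>f\<close> and invert it, as \<open>f\<^sup>2 \<noteq> \<one>\<close>, so the centralizer of \<open>f\<close> contains no moved
  element. Moved elements invert \<open>f\<close> by \<open>moved_inverts_fixed\<close>. For a fixed \<open>w\<close> that does not commute
  with \<open>f\<close>, the product \<open>w f\<close> is moved, as otherwise \<open>h\<close> would invert \<open>w\<close>, \<open>f\<close> and \<open>w f\<close>; so \<open>w f\<close>
  inverts \<open>f\<close>, and then so does \<open>w\<close>.
\<close>

lemma splitting_if_fixes_noninvolution:
  assumes h: "h \<in> carrier G" "\<phi> h \<noteq> h"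
    and f: "f \<in> carrier G" "\<phi> f = f" "f \<otimes> f \<noteq> \<one>"
  shows "dicyclic_splitting G {c \<in> carrier G. c \<otimes> f = f \<otimes> c} h"
proof (rule centralizer_splitting)
  fix c assume c: "c \<in> carrier G" "c \<otimes> f = f \<otimes> c"
  have "\<phi> c = c"
  proof (rule ccontr)
    assume "\<phi> c \<noteq> c"
    then have "f \<otimes> c = inv f \<otimes> c" using c f moved_inverts_fixed by metis
    then have "f = inv f" using c f by simp
    then show False using f by (metis r_inv)
  qed
  then show "h \<otimes> c = inv c \<otimes> h" using h c by (intro moved_inverts_fixed)
next
  fix w assume w: "w \<in> carrier G" "w \<otimes> f \<noteq> f \<otimes> w"
  show "w \<otimes> f = inv f \<otimes> w"
  proof (cases "\<phi> w = w")
    case True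
    have "\<phi> (w \<otimes> f) \<noteq> w \<otimes> f"
    proof
      assume "\<phi> (w \<otimes> f) = w \<otimes> f"
      then have "w \<otimes> f = f \<otimes> w"
        using h w f True by (intro inverts_product_imp_commute[of h] moved_inverts_fixed) auto
      then show False using w by simp
    qed
    then have "w \<otimes> f \<otimes> f = inv f \<otimes> (w \<otimes> f)"
      using w f by (intro moved_inverts_fixed) auto
    then show ?thesis using w f by (simp flip: m_assoc)
  next
    case False
    then show ?thesis using w f by (intro moved_inverts_fixed)
  qed
qed (use f h moved in auto)

text \<open>
  Here \<open>\<phi>\<close> is inversion, and its fixed elements turn out to be central. Non-commuting \<open>u\<close>, \<open>v\<close> are
  therefore both moved, whence \<open>u\<^sup>2 = v\<^sup>2\<close>. As \<open>u v\<close> and \<open>v\<close> do not commute either,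
  \<open>(u v)\<^sup>2 = u\<^sup>2\<close>, which says that \<open>u\<close> inverts \<open>v\<close>; in other words, \<open>u\<close> and \<open>v\<close> generate a
  quaternion group.
\<close>

lemma splitting_if_fixes_only_involutions:
  assumes nonab: "\<not> comm_group G" and h: "h \<in> carrier G" "\<phi> h \<noteq> h"
    and fixed: "\<And>f. \<lbrakk>f \<in> carrier G; \<phi> f = f\<rbrakk> \<Longrightarrow> f \<otimes> f = \<one>"
  shows "\<exists>C x. dicyclic_splitting G C x"
proof -
  have inv_fixed: "inv f = f" if "f \<in> carrier G" "\<phi> f = f" for f
    using that fixed inv_equality by blast
  have commute_moved: "k \<otimes> f = f \<otimes> k"
    if "f \<in> carrier G" "\<phi> f = f" "k \<in> carrier G" "\<phi> k \<noteq> k" for f k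
    using moved_inverts_fixed[of k f] that inv_fixed by simp
  have central: "f \<otimes> k = k \<otimes> f" if f: "f \<in> carrier G" "\<phi> f = f" and k: "k \<in> carrier G" for f k
  proof (cases "\<phi> k = k")
    case False
    then show ?thesis using commute_moved f k by simp
  next
    case True
    have hk: "h \<otimes> k = k \<otimes> h" using commute_moved[OF k True h] .
    \<comment> \<open>Two fixed elements are not comparable directly, so \<open>k\<close> is replaced by the moved element \<open>k h\<close>.\<close>
    have "\<phi> (k \<otimes> h) \<noteq> k \<otimes> h"
    proof
      assume "\<phi> (k \<otimes> h) = k \<otimes> h"
      then have "k \<otimes> h \<otimes> (k \<otimes> h) = \<one>" using fixed k h by simp
      then have "k \<otimes> k \<otimes> (h \<otimes> h) = \<one>" using hk k h by (metis m_assoc m_closed)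
      then show False using fixed[OF k True] moved(2)[OF h] h by simp
    qed
    then have "k \<otimes> h \<otimes> f = f \<otimes> (k \<otimes> h)" using commute_moved f k h by simp
    moreover have "k \<otimes> h \<otimes> f = k \<otimes> f \<otimes> h" using commute_moved[OF f h] f k h by (simp add: m_assoc)
    ultimately show ?thesis using f k h by (simp flip: m_assoc)
  qed
  have squares: "u \<otimes> u = v \<otimes> v"
    if "u \<in> carrier G" "v \<in> carrier G" "u \<otimes> v \<noteq> v \<otimes> u" for u v
    using that central moved_commute_or_squares_eq by metis
  have inverts: "u \<otimes> v = inv v \<otimes> u"
    if uv: "u \<in> carrier G" "v \<in> carrier G" "u \<otimes> v \<noteq> v \<otimes> u" for u v
  proof (rule inverts_if_square_left_eq)
    have "u \<otimes> v \<otimes> v \<noteq> v \<otimes> (u \<otimes> v)" using uv by (simp flip: m_assoc)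
    then show "u \<otimes> v \<otimes> (u \<otimes> v) = u \<otimes> u" using uv squares[of "u \<otimes> v" v] squares[of u v] by simp
  qed (use uv in auto)
  obtain g x where gx: "g \<in> carrier G" "x \<in> carrier G" "x \<otimes> g \<noteq> g \<otimes> x"
    using nonab group_comm_groupI by blast
  have "dicyclic_splitting G {c \<in> carrier G. c \<otimes> g = g \<otimes> c} x"
  proof (rule centralizer_splitting)
    show "x \<otimes> x \<noteq> \<one>" using gx central moved(2) by metis
    fix c assume c: "c \<in> carrier G" "c \<otimes> g = g \<otimes> c"
    \<comment> \<open>\<open>c x\<close> and \<open>x\<close> do not commute with \<open>g\<close>, so both have square \<open>g\<^sup>2\<close>.\<close>
    have "c \<otimes> x \<otimes> g \<noteq> g \<otimes> (c \<otimes> x)"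
    proof
      assume "c \<otimes> x \<otimes> g = g \<otimes> (c \<otimes> x)"
      also have "\<dots> = g \<otimes> c \<otimes> x" using c gx by (simp add: m_assoc)
      also have "\<dots> = c \<otimes> g \<otimes> x" using c by simp
      finally have "c \<otimes> (x \<otimes> g) = c \<otimes> (g \<otimes> x)" using c(1) gx by (simp add: m_assoc)
      then show False using c(1) gx by simp
    qed
    then have "c \<otimes> x \<otimes> (c \<otimes> x) = x \<otimes> x" using c gx squares[of "c \<otimes> x" g] squares[of x g] by simp
    then show "x \<otimes> c = inv c \<otimes> x" using c gx by (intro inverts_if_square_right_eq)
  qed (use gx inverts in auto)
  then show ?thesis by blast
qed

theorem generalized_dicyclic_if_moved:
  assumes "\<not> comm_group G" "h \<in> carrier G" "\<phi> h \<noteq> h"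
  shows "generalized_dicyclic G"
proof -
  obtain C x where splitting: "dicyclic_splitting G C x"
  proof (cases "\<exists>f\<in>carrier G. \<phi> f = f \<and> f \<otimes> f \<noteq> \<one>")
    case True
    then show thesis using splitting_if_fixes_noninvolution[OF assms(2,3)] that by blast
  next
    case False
    then show thesis using splitting_if_fixes_only_involutions[OF assms] that by blast
  qed
  then show ?thesis using assms(1) by (rule dicyclic_splitting.generalized_dicyclic)
qed

end

section \<open>Groups of at most continuum size that are not generalized dicyclic\<close>

text \<open>
  Distinct points get distances in \<open>[1, 2)\<close>, where the triangle inequality always holds. The interval has
  room for an injective image of \<open>G\<close>; evaluating the injection at a representative \<open>r g\<close> of
  \<open>{g, g\<^sup>-\<^sup>1}\<close> gives the symmetric function of \<open>u v\<^sup>-\<^sup>1\<close> that is needed.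
\<close>

lemma (in group) ex_metric_determining_differences:
  assumes "carrier G \<lesssim> (UNIV :: nat set set)"
  obtains d where "Metric_space (carrier G) d" "right_translations_isometric G d"
    and "\<And>u v u' v'. \<lbrakk>u \<in> carrier G; v \<in> carrier G; u' \<in> carrier G; v' \<in> carrier G; d u v = d u' v'\<rbrakk>
      \<Longrightarrow> u \<otimes> inv v = u' \<otimes> inv v' \<or> u \<otimes> inv v = v' \<otimes> inv u'"
proof -
  obtain e :: "'a \<Rightarrow> real" where e: "inj_on e (carrier G)" "e ` carrier G \<subseteq> {0..<1}"
    using lepoll_trans[OF assms nat_sets_lepoll_reals01] by (auto simp: lepoll_def)
  define r where "r g = (SOME h. h \<in> {g, inv g})" for g
  \<comment> \<open>The choice depends on the set \<open>{g, g\<^sup>-\<^sup>1}\<close> alone, which gives \<open>r_inv\<close> below.\<close>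
  have r: "r g = g \<or> r g = inv g" for g
    using someI[of "\<lambda>h. h \<in> {g, inv g}" g] by (auto simp: r_def)
  have r_inv: "r (inv g) = r g" if "g \<in> carrier G" for g
    using that by (simp add: r_def insert_commute)
  have r_closed: "r g \<in> carrier G" if "g \<in> carrier G" for g
    using r[of g] that by auto
  have r_eq: "g = h \<or> g = inv h" if "r g = r h" "g \<in> carrier G" "h \<in> carrier G" for g h
    using r[of g] r[of h] that by (metis inv_inv)
  have e_bounds: "0 \<le> e (r g)" "e (r g) < 1" if "g \<in> carrier G" for g
    using e(2) r_closed[OF that] by auto
  \<comment> \<open>The symmetry required of a metric is not confined to \<open>G\<close>, so \<open>d\<close> is made zero off \<open>G\<close>.\<close>
  define d where "d u v = (if u \<in> carrier G \<and> v \<in> carrier G \<and> u \<noteq> v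
    then 1 + e (r (u \<otimes> inv v)) else 0)" for u v
  have "Metric_space (carrier G) d"
  proof
    show "0 \<le> d u v" for u v using e_bounds[of "u \<otimes> inv v"] by (simp add: d_def)
    show "d u v = d v u" for u v
      using r_inv[of "v \<otimes> inv u"] by (auto simp: d_def inv_mult_group)
    show "d u v = 0 \<longleftrightarrow> u = v" if "u \<in> carrier G" "v \<in> carrier G" for u v
      using that e_bounds(1)[of "u \<otimes> inv v"] by (simp add: d_def)
    show "d u w \<le> d u v + d v w" if "u \<in> carrier G" "v \<in> carrier G" "w \<in> carrier G" for u v w
      using that e_bounds[of "u \<otimes> inv v"] e_bounds[of "v \<otimes> inv w"] e_bounds[of "u \<otimes> inv w"]
      by (auto simp: d_def)
  qed
  moreover have "right_translations_isometric G d"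
    by (auto simp: right_translations_isometric_def self_isometry_def bij_betw_right_mult d_def group_word)
  moreover have "u \<otimes> inv v = u' \<otimes> inv v' \<or> u \<otimes> inv v = v' \<otimes> inv u'"
    if uv: "u \<in> carrier G" "v \<in> carrier G" "u' \<in> carrier G" "v' \<in> carrier G" and eq: "d u v = d u' v'"
    for u v u' v'
  proof (cases "u = v \<or> u' = v'")
    case True
    have "1 + e (r (u \<otimes> inv v)) \<noteq> 0" "1 + e (r (u' \<otimes> inv v')) \<noteq> 0"
      using e_bounds(1)[of "u \<otimes> inv v"] e_bounds(1)[of "u' \<otimes> inv v'"] uv by auto
    then show ?thesis using True eq uv by (auto simp: d_def split: if_splits)
  next
    case False
    then have "e (r (u \<otimes> inv v)) = e (r (u' \<otimes> inv v'))" using eq uv by (simp add: d_def)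
    then have "r (u \<otimes> inv v) = r (u' \<otimes> inv v')"
      using e(1) uv r_closed by (simp add: inj_on_eq_iff)
    then show ?thesis using r_eq uv by (fastforce simp: inv_mult_group)
  qed
  ultimately show thesis by (rule that)
qed

text \<open>
  The isomorphism sends \<open>b\<close> to the element of \<open>G\<close> that induces the same translation, which is found by
  evaluating at the unit of \<open>G\<close>. It is bijective because it is a left translation of \<open>H\<close>.
\<close>

lemma (in group) iso_if_right_mults_agree:
  fixes H (structure)
  assumes "group H" and carrier: "carrier H = carrier G"
    and s: "\<And>b. b \<in> carrier G \<Longrightarrow> \<exists>s\<in>carrier G. \<forall>u\<in>carrier G. u \<otimes>\<^bsub>H\<^esub> b = u \<otimes>\<^bsub>G\<^esub> s"
  shows "H \<cong> G"
proof -
  interpret H: group H by fact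
  let ?s = "\<lambda>b. \<one>\<^bsub>G\<^esub> \<otimes>\<^bsub>H\<^esub> b"
  have s_closed: "?s b \<in> carrier G" if "b \<in> carrier G" for b
    using that carrier H.m_closed[of "\<one>\<^bsub>G\<^esub>" b] by simp
  have translation: "u \<otimes>\<^bsub>H\<^esub> b = u \<otimes>\<^bsub>G\<^esub> ?s b" if "u \<in> carrier G" "b \<in> carrier G" for u b
    using s[OF that(2)] that by fastforce
  have "?s \<in> hom H G"
  proof (rule homI)
    fix a b assume "a \<in> carrier H" "b \<in> carrier H"
    then have ab: "a \<in> carrier G" "b \<in> carrier G" using carrier by simp_all
    have "?s (a \<otimes>\<^bsub>H\<^esub> b) = ?s a \<otimes>\<^bsub>H\<^esub> b" using ab carrier by (simp add: H.m_assoc)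
    also have "\<dots> = ?s a \<otimes>\<^bsub>G\<^esub> ?s b" using ab s_closed by (intro translation)
    finally show "?s (a \<otimes>\<^bsub>H\<^esub> b) = ?s a \<otimes>\<^bsub>G\<^esub> ?s b" .
  qed (use s_closed carrier in auto)
  moreover have "bij_betw ?s (carrier H) (carrier G)"
    using H.inj_on_cmult[of "\<one>\<^bsub>G\<^esub>"] H.surj_const_mult[of "\<one>\<^bsub>G\<^esub>"] carrier by (simp add: bij_betw_def)
  ultimately show ?thesis by (intro is_isoI isoI)
qed

theorem (in group) natural_if_not_generalized_dicyclic:
  assumes nonab: "\<not> comm_group G" and card: "carrier G \<lesssim> (UNIV :: nat set set)"
    and nondic: "\<not> generalized_dicyclic G"
  shows "natural_group G"
proof -
  obtain d where d: "Metric_space (carrier G) d" "right_translations_isometric G d"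
    and d_eq: "\<And>u v u' v'. \<lbrakk>u \<in> carrier G; v \<in> carrier G; u' \<in> carrier G; v' \<in> carrier G; d u v = d u' v'\<rbrakk>
      \<Longrightarrow> u \<otimes> inv v = u' \<otimes> inv v' \<or> u \<otimes> inv v = v' \<otimes> inv u'"
    using ex_metric_determining_differences[OF card] by blast
  have "H \<cong> G" if "group H" and carrier: "carrier H = carrier G" and H: "right_translations_isometric H d"
    for H :: "'a monoid"
  proof (rule iso_if_right_mults_agree)
    fix b assume b: "b \<in> carrier G"
    let ?s = "\<one> \<otimes>\<^bsub>H\<^esub> b"
    \<comment> \<open>The translation by \<open>b\<close> in \<open>H\<close>, corrected by a translation of \<open>G\<close> so as to fix \<open>\<one>\<close>.\<close>
    define \<phi> where "\<phi> u = (u \<otimes>\<^bsub>H\<^esub> b) \<otimes> inv ?s" for u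
    have H_closed: "u \<otimes>\<^bsub>H\<^esub> b \<in> carrier G" if "u \<in> carrier G" for u
      using that b carrier \<open>group H\<close> by (metis group.is_monoid monoid.m_closed)
    have cancel: "\<phi> u \<otimes> inv \<phi> v = (u \<otimes>\<^bsub>H\<^esub> b) \<otimes> inv (v \<otimes>\<^bsub>H\<^esub> b)"
      if "u \<in> carrier G" "v \<in> carrier G" for u v
      using that H_closed by (simp add: \<phi>_def group_word)
    interpret difference_preserving_up_to_inverse G \<phi>
    proof
      show "\<phi> u \<in> carrier G" if "u \<in> carrier G" for u
        using that H_closed by (simp add: \<phi>_def)
      show "\<phi> \<one> = \<one>" using H_closed by (simp add: \<phi>_def)
      show "\<phi> u \<otimes> inv \<phi> v = u \<otimes> inv v \<or> \<phi> u \<otimes> inv \<phi> v = v \<otimes> inv u"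
        if uv: "u \<in> carrier G" "v \<in> carrier G" for u v
        using uv b H carrier H_closed unfolding cancel[OF uv]
        by (intro d_eq) (auto simp: right_translations_isometric_def self_isometry_def)
    qed
    have "u \<otimes>\<^bsub>H\<^esub> b = u \<otimes> ?s" if u: "u \<in> carrier G" for u
    proof -
      have "\<phi> u = u" using generalized_dicyclic_if_moved nonab nondic u by blast
      then show ?thesis using u H_closed by (simp add: \<phi>_def inv_solve_right')
    qed
    then show "\<exists>s\<in>carrier G. \<forall>u\<in>carrier G. u \<otimes>\<^bsub>H\<^esub> b = u \<otimes> s" using H_closed by blast
  qed fact+
  then show ?thesis using d is_group unfolding natural_group_def by blast
qed

theorem theorem3:
  fixes G :: "('a, 'b) monoid_scheme"
  assumes "group G"
    and "\<not> comm_group G"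
    and "carrier G \<lesssim> (UNIV :: nat set set)"
  shows "natural_group G \<longleftrightarrow> \<not> generalized_dicyclic G"
proof -
  interpret group G by fact
  have "\<not> natural_group G" if dicyclic: "generalized_dicyclic G"
  proof -
    obtain C x where splitting: "dicyclic_splitting G C x"
      using generalized_dicyclic_splitting[OF dicyclic] .
    show ?thesis
      by (rule dicyclic_splitting.not_natural[OF splitting assms(2)])
  qed
  moreover have "natural_group G" if "\<not> generalized_dicyclic G"
    by (rule natural_if_not_generalized_dicyclic[OF assms(2,3) that])
  ultimately show ?thesis by argo
qed

end
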